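(* Let $R$ be a polynomial ring over a field and let $I$ be a square-free monomial ideal in $R$. Assume that the generator graph $\widetilde{G}(I)$ is a disjoint union of trees and of connected graphs that contain exactly one cycle, that cycle having odd length. Then $I$ is an ideal of linear type.
   Context: Let $f_1,\ldots,f_n$ be the minimal monomial generating set of $I$. The generator graph $\widetilde{G}(I)$ has vertices $y_1,\ldots,y_n$ (one for each $f_i$) and an edge $\{y_i,y_j\}$ for $i\neq j$ exactly when $\gcd(f_i,f_j)\neq 1$. The Rees algebra is $\mathcal{R}(I)=R[It]\subset R[t]$. Let $S=R[T_1,\ldots,T_n]$, let $\phi:S\to\mathcal{R}(I)$ be the $R$-algebra epimorphism with $\phi(T_i)=f_it$, and $J=\ker\phi$, graded by degree in the $T_i$. The ideal $I$ is of linear type if $J$ is generated by its elements of degree $1$ in the $T_i$ (equivalently, ${\rm Sym}(I)\to\mathcal{R}(I)$ is an isomorphism). *)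

theory Defs
  imports
    "HOL-Library.Poly_Mapping"
    "HOL-Library.Disjoint_Sets"
    "HOL-Computational_Algebra.Polynomial"
    "HOL-Algebra.Generated_Rings"
begin

section \<open>Polynomial rings\<close>

text \<open>
  A polynomial in variables of type \<open>'v\<close> is a finitely supported map from exponent vectors to
  coefficients, with the convolution product of \<^theory>\<open>HOL-Library.Poly_Mapping\<close>. The base ring
  \<open>R\<close> is \<open>('x, 'k) mpoly\<close> with \<open>'x\<close> a finite type and \<open>'k\<close> a field.
\<close>

type_synonym ('v, 'a) mpoly = "('v \<Rightarrow>\<^sub>0 nat) \<Rightarrow>\<^sub>0 'a"

text \<open>
  \<open>ring_on A\<close> is the HOL-Algebra ring with the type-class operations and carrier \<open>A\<close>. It gives
  access to the library's generated ideals, generated subrings and kernels.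
\<close>

definition ring_on :: "'a::comm_ring_1 set \<Rightarrow> 'a ring" where
  "ring_on A = \<lparr>carrier = A, monoid.mult = (*), one = 1, zero = 0, add = (+)\<rparr>"

abbreviation ideal_gen :: "'a::comm_ring_1 set \<Rightarrow> 'a set" where
  "ideal_gen G \<equiv> genideal (ring_on UNIV) G"

definition monomial_of :: "('x \<Rightarrow>\<^sub>0 nat) \<Rightarrow> ('x, 'k::comm_ring_1) mpoly" where
  "monomial_of a = Poly_Mapping.single a 1"

definition squarefree_monomial_ideal :: "('x, 'k::comm_ring_1) mpoly set \<Rightarrow> bool" where
  "squarefree_monomial_ideal I \<longleftrightarrow>
     (\<exists>A. (\<forall>a\<in>A. \<forall>x. Poly_Mapping.lookup a x \<le> 1) \<and> I = ideal_gen (monomial_of ` A))"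

text \<open>\<open>f 0, \<dots>, f (n - 1)\<close> enumerates, without repetition, the minimal monomial generating set of \<open>I\<close>.\<close>

definition minimal_monomial_generators ::
  "('x, 'k::comm_ring_1) mpoly set \<Rightarrow> nat \<Rightarrow> (nat \<Rightarrow> ('x, 'k) mpoly) \<Rightarrow> bool" where
  "minimal_monomial_generators I n f \<longleftrightarrow>
     inj_on f {..<n} \<and>
     f ` {..<n} \<subseteq> range monomial_of \<and>
     ideal_gen (f ` {..<n}) = I \<and>
     (\<forall>H. H \<subset> f ` {..<n} \<longrightarrow> ideal_gen H \<noteq> I)"

section \<open>Simple graphs\<close>

text \<open>A graph is a pair of a vertex set and a set of two-element subsets of it.\<close>

type_synonym 'v ugraph = "'v set \<times> 'v set set"

definition connected_ugraph :: "'v ugraph \<Rightarrow> bool" where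
  "connected_ugraph G \<longleftrightarrow> fst G \<noteq> {} \<and>
     (\<forall>u\<in>fst G. \<forall>v\<in>fst G. (u, v) \<in> {(a, b). {a, b} \<in> snd G}\<^sup>*)"

text \<open>
  A cycle is a subgraph, so it is represented by its edge set; the vertex lists \<open>vs\<close> obtained by
  rotating or reversing one another describe the same cycle. Its length is its number of edges.
\<close>

definition cycle_edges :: "'v list \<Rightarrow> 'v set set" where
  "cycle_edges vs = {{vs ! i, vs ! (Suc i mod length vs)} | i. i < length vs}"

definition cycles :: "'v ugraph \<Rightarrow> 'v set set set" where
  "cycles G = {cycle_edges vs | vs. 3 \<le> length vs \<and> distinct vs \<and> set vs \<subseteq> fst G
                                  \<and> cycle_edges vs \<subseteq> snd G}"

definition tree :: "'v ugraph \<Rightarrow> bool" where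
  "tree G \<longleftrightarrow> connected_ugraph G \<and> cycles G = {}"

definition odd_unicyclic :: "'v ugraph \<Rightarrow> bool" where
  "odd_unicyclic G \<longleftrightarrow> connected_ugraph G \<and> (\<exists>C. cycles G = {C} \<and> odd (card C))"

definition disjoint_union_of :: "('v ugraph \<Rightarrow> bool) \<Rightarrow> 'v ugraph \<Rightarrow> bool" where
  "disjoint_union_of P G \<longleftrightarrow>
     (\<exists>W. partition_on (fst G) W \<and> (\<forall>e\<in>snd G. \<exists>U\<in>W. e \<subseteq> U)
          \<and> (\<forall>U\<in>W. P (U, snd G \<inter> Pow U)))"

section \<open>The generator graph\<close>

text \<open>
  The type of polynomials is not an instance of the \<open>gcd\<close> type classes. Since \<open>1\<close> is a greatest
  common divisor of \<open>p\<close> and \<open>q\<close> iff every common divisor divides \<open>1\<close>, the condition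
  \<open>gcd p q \<noteq> 1\<close> unfolds to \<open>\<not> gcd_is_one p q\<close>.
\<close>

definition gcd_is_one :: "'a::comm_ring_1 \<Rightarrow> 'a \<Rightarrow> bool" where
  "gcd_is_one p q \<longleftrightarrow> (\<forall>c. c dvd p \<longrightarrow> c dvd q \<longrightarrow> c dvd 1)"

definition generator_graph :: "nat \<Rightarrow> (nat \<Rightarrow> ('x, 'k::comm_ring_1) mpoly) \<Rightarrow> nat ugraph" where
  "generator_graph n f =
     ({..<n}, {{i, j} | i j. i < n \<and> j < n \<and> i \<noteq> j \<and> \<not> gcd_is_one (f i) (f j)})"

section \<open>Rees algebras and ideals of linear type\<close>

text \<open>\<open>R[t]\<close> is the type \<open>'r poly\<close>; the Rees algebra is the \<open>R\<close>-subalgebra generated by \<open>It\<close>.\<close>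

definition rees_algebra :: "'r::comm_ring_1 set \<Rightarrow> 'r poly ring" where
  "rees_algebra I =
     ring_on (generate_ring (ring_on UNIV) (range (\<lambda>r. [:r:]) \<union> (\<lambda>a. [:0, a:]) ` I))"

text \<open>
  \<open>S = R[T\<^sub>0, \<dots>, T\<^sub>n\<^sub>-\<^sub>1]\<close>, as the subring of those polynomials in countably many variables
  over \<open>R\<close> in which only the first \<open>n\<close> variables occur. In this way \<open>n\<close> can be an arbitrary
  natural number, including \<open>0\<close>.
\<close>

definition rees_source :: "nat \<Rightarrow> (nat, 'r::comm_ring_1) mpoly ring" where
  "rees_source n = ring_on {p. \<forall>m\<in>Poly_Mapping.keys p. Poly_Mapping.keys m \<subseteq> {..<n}}"

definition rees_map :: "nat \<Rightarrow> (nat \<Rightarrow> 'r::comm_ring_1) \<Rightarrow> (nat, 'r) mpoly \<Rightarrow> 'r poly" where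
  "rees_map n f p = (\<Sum>m\<in>Poly_Mapping.keys p. [:Poly_Mapping.lookup p m:] * (\<Prod>i<n. [:0, f i:] ^ Poly_Mapping.lookup m i))"

definition rees_relations ::
  "'r::comm_ring_1 set \<Rightarrow> nat \<Rightarrow> (nat \<Rightarrow> 'r) \<Rightarrow> (nat, 'r) mpoly set" where
  "rees_relations I n f = a_kernel (rees_source n) (rees_algebra I) (rees_map n f)"

definition linear_forms :: "nat \<Rightarrow> (nat, 'r::comm_ring_1) mpoly set" where
  "linear_forms n = {p \<in> carrier (rees_source n). \<forall>m\<in>Poly_Mapping.keys p. (\<Sum>i<n. Poly_Mapping.lookup m i) = 1}"

text \<open>
  \<open>I\<close>, generated by \<open>f 0, \<dots>, f (n - 1)\<close>, is of linear type: the relations among the \<open>f i t\<close> in the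
  Rees algebra are generated, as an ideal of \<open>S\<close>, by those of degree 1 in the \<open>T\<^sub>i\<close>.
\<close>

definition linear_type :: "'r::comm_ring_1 set \<Rightarrow> nat \<Rightarrow> (nat \<Rightarrow> 'r) \<Rightarrow> bool" where
  "linear_type I n f \<longleftrightarrow>
     rees_relations I n f =
       genideal (rees_source n) (rees_relations I n f \<inter> linear_forms n)"

end

theory Submission
  imports Defs
begin

text \<open>
  The relations are spanned by binomials. Modulo the linear relations, a binomial \<open>x\<^sup>a T\<^sup>u - x\<^sup>b T\<^sup>v\<close> reduces to one of lower degree.
  After cancelling common variables \<open>T\<^sub>i\<close>, the supports of \<open>u\<close> and \<open>v\<close> are disjoint; join \<open>i\<close> in
  one to \<open>j\<close> in the other if \<open>f\<^sub>i\<close> and \<open>f\<^sub>j\<close> share a variable. This bipartite graph has no cycle,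
  since it would be an even cycle of the generator graph, so it has a vertex of degree at most 1,
  say \<open>j\<close> in the support of \<open>v\<close> with no neighbour except possibly \<open>i\<close>. A variable of \<open>f\<^sub>j\<close> not in
  \<open>f\<^sub>i\<close> then occurs in no \<open>f\<^sub>k\<close> with \<open>k\<close> in the support of \<open>u\<close>, hence in \<open>x\<^sup>a\<close>. As \<open>f\<^sub>j\<close> is
  square-free, it divides \<open>x\<^sup>a f\<^sub>i\<close>, so a linear relation exchanges \<open>T\<^sub>i\<close> for \<open>T\<^sub>j\<close>, which can be
  cancelled.
\<close>

section \<open>Even cycles\<close>

text \<open>A walk in the finite set \<open>V\<close> that never turns back must repeat a vertex,
  and a return in the least number of steps traces a cycle. In \<open>step\<close>, \<open>p\<close>
  stands for the vertex the walk came from and \<open>q\<close> for the one it is at.\<close>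

lemma ex_cycle:
  fixes R :: "'v \<Rightarrow> 'v \<Rightarrow> bool"
  assumes "finite V" "V \<noteq> {}" and irrefl: "\<And>x. \<not> R x x"
    and step: "\<And>p q. p \<in> V \<Longrightarrow> q \<in> V \<Longrightarrow> \<exists>r\<in>V. r \<noteq> p \<and> R q r"
  shows "\<exists>vs. 3 \<le> length vs \<and> distinct vs \<and> set vs \<subseteq> V \<and>
           (\<forall>i<length vs. R (vs ! i) (vs ! (Suc i mod length vs)))"
proof -
  obtain v where v: "v \<in> V" using \<open>V \<noteq> {}\<close> by auto
  obtain nxt where nxt: "\<And>p q. p \<in> V \<Longrightarrow> q \<in> V \<Longrightarrow> nxt p q \<in> V \<and> nxt p q \<noteq> p \<and> R q (nxt p q)"
    using step by metis
  \<comment> \<open>\<open>s k\<close> holds two consecutive vertices of the walk, since the choice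
    of the next one depends on both. At the start \<open>v\<close> serves as its own
    predecessor.\<close>
  define s where "s k = ((\<lambda>(p, q). (q, nxt p q)) ^^ k) (v, nxt v v)" for k
  define w where "w k = fst (s k)" for k
  have s_Suc: "s (Suc k) = (snd (s k), nxt (fst (s k)) (snd (s k)))" for k
    by (simp add: s_def case_prod_unfold)
  have s: "fst (s k) \<in> V \<and> snd (s k) \<in> V \<and> R (fst (s k)) (snd (s k))" for k
  proof (induction k)
    case 0 show ?case using v nxt by (simp add: s_def)
  next
    case (Suc k) then show ?case using nxt by (simp add: s_Suc)
  qed
  have wV: "w k \<in> V" and wR: "R (w k) (w (Suc k))" and wne: "w (Suc (Suc k)) \<noteq> w k" for k
    using s[of k] nxt by (auto simp: w_def s_Suc)
  \<comment> \<open>\<open>P l\<close>: some vertex of the walk recurs after \<open>l\<close> steps.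
    For the least such \<open>l\<close>, two equal vertices among the \<open>l\<close> positions of
    the stretch would give a shorter return, so its vertices are distinct.\<close>
  define P where "P l \<longleftrightarrow> l > 0 \<and> (\<exists>i. w (i + l) = w i)" for l
  have "\<exists>l. P l"
  proof -
    have "finite (range w)" using wV \<open>finite V\<close> by (auto intro: finite_subset)
    then have "\<not> inj w" using finite_imageD by auto
    then obtain i j where "w i = w j" "i < j"
      by (metis inj_on_def nat_neq_iff)
    then have "P (j - i)" by (auto simp: P_def intro!: exI[of _ i])
    then show ?thesis ..
  qed
  then obtain l where l: "P l" and least: "\<And>k. k < l \<Longrightarrow> \<not> P k"
    using exists_least_iff by metis
  then obtain i where i: "l > 0" "w (i + l) = w i" by (auto simp: P_def)
  \<comment> \<open>Irreflexivity rules out a return after one step, and never turning back rules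
    out one after two.\<close>
  have "l \<noteq> 1" using i wR[of i] irrefl by auto
  moreover have "l \<noteq> 2" using i wne[of i] by (auto simp: numeral_2_eq_2)
  ultimately have l3: "3 \<le> l" using i by linarith
  define vs where "vs = map (\<lambda>k. w (i + k)) [0..<l]"
  have nth: "vs ! k = w (i + k)" if "k < l" for k using that by (simp add: vs_def)
  have ne: "w (i + a) \<noteq> w (i + b)" if "a < b" "b < l" for a b
  proof
    assume eq: "w (i + a) = w (i + b)"
    have "P (b - a)" unfolding P_def
      using that eq by (auto intro!: exI[of _ "i + a"])
    then show False using least[of "b - a"] that by auto
  qed
  have "distinct vs"
    unfolding vs_def distinct_map using ne by (auto intro!: inj_onI) (metis nat_neq_iff)
  moreover have "R (vs ! k) (vs ! (Suc k mod l))" if "k < l" for k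
  proof (cases "Suc k = l")
    case True then show ?thesis using wR[of "i + k"] i nth[of k] nth[of 0] by auto
  next
    case False then show ?thesis using that wR[of "i + k"] nth[of k] nth[of "Suc k"] by auto
  qed
  ultimately show ?thesis
    using l3 wV by (intro exI[of _ vs]) (auto simp: vs_def)
qed

text \<open>Colours alternate along the list, and the closing edge gives the last vertex the colour
  opposite to the first. So the last index is odd, and the length is one more.\<close>

lemma even_length_2_coloured_cycle:
  assumes "vs \<noteq> []" and c: "\<And>x y. R x y \<Longrightarrow> c x \<longleftrightarrow> \<not> c y"
    and R: "\<forall>i<length vs. R (vs ! i) (vs ! (Suc i mod length vs))"
  shows "even (length vs)"
proof -
  have col: "k < length vs \<Longrightarrow> c (vs ! k) \<longleftrightarrow> (even k \<longleftrightarrow> c (vs ! 0))" for k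
  proof (induction k)
    case (Suc k)
    then have "R (vs ! k) (vs ! Suc k)" using R[rule_format, of k] by auto
    then show ?case using Suc c by fastforce
  qed auto
  obtain l where l: "length vs = Suc l" using \<open>vs \<noteq> []\<close> by (cases vs) auto
  then have "c (vs ! l) \<longleftrightarrow> \<not> c (vs ! 0)" using R c by fastforce
  then show ?thesis using col[of l] l by auto
qed

text \<open>Links the length of a cycle as an edge set to the length of a vertex list, on which
  parity is computed.\<close>

lemma card_cycle_edges:
  assumes "3 \<le> length vs" "distinct vs"
  shows "card (cycle_edges vs) = length vs"
proof -
  let ?l = "length vs"
  have "inj_on (\<lambda>i. {vs ! i, vs ! (Suc i mod ?l)}) {..<?l}"
  proof (rule inj_onI)
    fix i j assume ij: "i \<in> {..<?l}" "j \<in> {..<?l}"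
      and eq: "{vs ! i, vs ! (Suc i mod ?l)} = {vs ! j, vs ! (Suc j mod ?l)}"
    have lt: "Suc k mod ?l < ?l" for k using assms by (intro mod_less_divisor) auto
    \<comment> \<open>If one edge occurs at two indices, each index is the cyclic successor of the
      other, which needs length at most 2.\<close>
    have "i = j \<or> i = Suc j mod ?l \<and> Suc i mod ?l = j"
      using eq ij lt assms(2) by (auto simp: doubleton_eq_iff nth_eq_iff_index_eq)
    moreover have "\<not> (i = Suc j mod ?l \<and> Suc i mod ?l = j)"
      using ij assms(1) by (auto simp: mod_Suc split: if_splits)
    ultimately show "i = j" by blast
  qed
  moreover have "cycle_edges vs = (\<lambda>i. {vs ! i, vs ! (Suc i mod ?l)}) ` {..<?l}"
    by (auto simp: cycle_edges_def)
  ultimately show ?thesis by (simp add: card_image)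
qed

text \<open>Every edge lies in a block of the partition and blocks are disjoint, so a cycle stays in
  the block of its first vertex. There it is a cycle of a tree, which is impossible, or the one odd
  cycle.\<close>

lemma odd_cycle_if_components_tree_or_odd_unicyclic:
  assumes G: "disjoint_union_of (\<lambda>H. tree H \<or> odd_unicyclic H) G"
    and vs: "3 \<le> length vs" "distinct vs" "set vs \<subseteq> fst G" "cycle_edges vs \<subseteq> snd G"
  shows "odd (length vs)"
proof -
  let ?l = "length vs"
  obtain W where W: "partition_on (fst G) W" and E: "\<And>e. e \<in> snd G \<Longrightarrow> \<exists>U\<in>W. e \<subseteq> U"
    and H: "\<And>U. U \<in> W \<Longrightarrow> tree (U, snd G \<inter> Pow U) \<or> odd_unicyclic (U, snd G \<inter> Pow U)"
    using G unfolding disjoint_union_of_def by blast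
  have "vs ! 0 \<in> fst G" using vs by (metis nth_mem not_numeral_le_zero not_gr_zero subsetD)
  then obtain U where U: "U \<in> W" "vs ! 0 \<in> U" using W by (auto simp: partition_on_def)
  have edge: "{vs ! k, vs ! (Suc k mod ?l)} \<in> snd G" if "k < ?l" for k
    using that vs(4) by (auto simp: cycle_edges_def)
  have inU: "k < ?l \<Longrightarrow> vs ! k \<in> U" for k
  proof (induction k)
    case (Suc k)
    then obtain U' where U': "U' \<in> W" "{vs ! k, vs ! Suc k} \<subseteq> U'"
      using E[OF edge[of k]] by auto
    then have "U' = U"
      using Suc U W partition_onD2[OF W] by (auto dest: disjointD)
    then show ?case using U' by auto
  qed (use U in auto)
  have setU: "set vs \<subseteq> U" using inU by (auto simp: set_conv_nth)
  moreover have "cycle_edges vs \<subseteq> Pow U"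
    using inU vs(1) by (auto simp: cycle_edges_def intro!: inU mod_less_divisor)
  ultimately have "cycle_edges vs \<in> cycles (U, snd G \<inter> Pow U)"
    using vs unfolding cycles_def by auto
  then have "odd (card (cycle_edges vs))"
    using H[OF U(1)] by (auto simp: tree_def odd_unicyclic_def)
  then show ?thesis using card_cycle_edges vs by metis
qed

text \<open>If every vertex had two neighbours on the other side, the edges between \<open>A\<close>
  and \<open>B\<close> would contain a cycle; it alternates between the sides, so its length is
  even, against \<open>odd\<close>. A leaf in this sense may also have no neighbour across.\<close>

lemma bipartite_leaf:
  fixes R :: "'v \<Rightarrow> 'v \<Rightarrow> bool"
  assumes fin: "finite A" "finite B" and ne: "A \<noteq> {}" "B \<noteq> {}" and disj: "A \<inter> B = {}"
    and sym: "\<And>x y. R x y \<Longrightarrow> R y x"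
    and odd: "\<And>vs. 3 \<le> length vs \<Longrightarrow> distinct vs \<Longrightarrow> set vs \<subseteq> A \<union> B \<Longrightarrow>
       (\<forall>i<length vs. vs ! i \<noteq> vs ! (Suc i mod length vs) \<and> R (vs ! i) (vs ! (Suc i mod length vs)))
       \<Longrightarrow> odd (length vs)"
  shows "(\<exists>i\<in>A. \<exists>j\<in>B. \<forall>i'\<in>A. i' \<noteq> i \<longrightarrow> \<not> R i' j) \<or> (\<exists>i\<in>A. \<exists>j\<in>B. \<forall>j'\<in>B. j' \<noteq> j \<longrightarrow> \<not> R i j')"
proof (rule ccontr)
  assume neg: "\<not> ?thesis"
  \<comment> \<open>\<open>Q\<close> discards the edges of \<open>R\<close> inside \<open>A\<close>
    or inside \<open>B\<close>, and with them the loops.\<close>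
  define Q where "Q x y \<longleftrightarrow> R x y \<and> x \<in> A \<union> B \<and> y \<in> A \<union> B \<and> (x \<in> A \<longleftrightarrow> y \<notin> A)" for x y
  have step: "\<exists>r\<in>A \<union> B. r \<noteq> p \<and> Q q r" if "q \<in> A \<union> B" for p q
  proof (cases "q \<in> A")
    case True
    \<comment> \<open>The negated claim gives a neighbour avoiding one chosen vertex of
      \<open>B\<close>. That vertex is \<open>p\<close> if \<open>p\<close> lies in
      \<open>B\<close>; otherwise all of \<open>B\<close> differs from \<open>p\<close>
      anyway.\<close>
    obtain j where "j \<in> B" "p \<in> B \<longrightarrow> j = p" using ne by auto
    then obtain j' where "j' \<in> B" "j' \<noteq> j" "R q j'" using neg True by blast
    then show ?thesis
      using \<open>p \<in> B \<longrightarrow> j = p\<close> disj True by (intro bexI[of _ j']) (auto simp: Q_def)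
  next
    case False
    then have q: "q \<in> B" using that by auto
    obtain i where "i \<in> A" "p \<in> A \<longrightarrow> i = p" using ne by auto
    then obtain i' where "i' \<in> A" "i' \<noteq> i" "R i' q" using neg q by blast
    then show ?thesis
      using \<open>p \<in> A \<longrightarrow> i = p\<close> disj False q sym by (intro bexI[of _ i']) (auto simp: Q_def)
  qed
  have irr: "\<not> Q x x" for x by (auto simp: Q_def)
  have "\<exists>vs. 3 \<le> length vs \<and> distinct vs \<and> set vs \<subseteq> A \<union> B \<and>
           (\<forall>i<length vs. Q (vs ! i) (vs ! (Suc i mod length vs)))"
  proof (rule ex_cycle)
    show "finite (A \<union> B)" "A \<union> B \<noteq> {}" using fin ne by auto
    show "\<not> Q x x" for x by (rule irr)
    show "\<exists>r\<in>A \<union> B. r \<noteq> p \<and> Q q r" if "q \<in> A \<union> B" for p q using that by (rule step)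
  qed
  then obtain vs where vs: "3 \<le> length vs" "distinct vs" "set vs \<subseteq> A \<union> B"
    and Q: "\<forall>i<length vs. Q (vs ! i) (vs ! (Suc i mod length vs))"
    by blast
  have col: "x \<in> A \<longleftrightarrow> \<not> y \<in> A" if "Q x y" for x y using that by (auto simp: Q_def)
  have "even (length vs)"
    using vs(1) by (intro even_length_2_coloured_cycle[OF _ col Q]) auto
  moreover have "odd (length vs)"
  proof (rule odd[OF vs], intro allI impI conjI)
    fix i assume "i < length vs"
    then have *: "Q (vs ! i) (vs ! (Suc i mod length vs))" using Q by blast
    then show "R (vs ! i) (vs ! (Suc i mod length vs))" by (simp add: Q_def)
    show "vs ! i \<noteq> vs ! (Suc i mod length vs)" using * unfolding Q_def by metis
  qed
  ultimately show False by blast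
qed

section \<open>Polynomials and ideals\<close>

lemma poly_mapping_eq_sum_single:
  fixes p :: "'a \<Rightarrow>\<^sub>0 'b::comm_monoid_add"
  shows "p = (\<Sum>m\<in>Poly_Mapping.keys p. Poly_Mapping.single m (Poly_Mapping.lookup p m))"
proof (rule poly_mapping_eqI)
  fix k
  have "(\<Sum>m\<in>Poly_Mapping.keys p. Poly_Mapping.lookup (Poly_Mapping.single m (Poly_Mapping.lookup p m)) k)
      = (\<Sum>m\<in>Poly_Mapping.keys p. if m = k then Poly_Mapping.lookup p m else 0)"
    by (intro sum.cong) (auto simp: lookup_single when_def)
  then show "Poly_Mapping.lookup p k =
      Poly_Mapping.lookup (\<Sum>m\<in>Poly_Mapping.keys p. Poly_Mapping.single m (Poly_Mapping.lookup p m)) k"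
    by (simp add: lookup_sum in_keys_iff)
qed

section \<open>Rings and ideals carried by subsets of a type\<close>

lemma ring_ring_on:
  assumes "0 \<in> A" "1 \<in> A" "\<And>x y. x \<in> A \<Longrightarrow> y \<in> A \<Longrightarrow> x + y \<in> A"
    "\<And>x y. x \<in> A \<Longrightarrow> y \<in> A \<Longrightarrow> x * y \<in> A" "\<And>x. x \<in> A \<Longrightarrow> - x \<in> A"
  shows "ring (ring_on A)"
proof (rule ringI)
  show "abelian_group (ring_on A)"
    by (rule abelian_groupI) (use assms in \<open>auto simp: ring_on_def algebra_simps intro: bexI[of _ "- x" for x]\<close>)
  show "monoid (ring_on A)"
    by (rule monoidI) (use assms in \<open>auto simp: ring_on_def algebra_simps\<close>)
qed (auto simp: ring_on_def algebra_simps)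

lemma ideal_ring_onI:
  fixes A :: "'a::comm_ring_1 set"
  assumes "ring (ring_on A)" and "-1 \<in> A" "J \<subseteq> A" "0 \<in> J"
    and "\<And>x y. x \<in> J \<Longrightarrow> y \<in> J \<Longrightarrow> x + y \<in> J"
    and mult: "\<And>x y. x \<in> A \<Longrightarrow> y \<in> J \<Longrightarrow> x * y \<in> J"
  shows "ideal J (ring_on A)"
proof (rule idealI)
  interpret ring "ring_on A" by fact
  show "subgroup J (add_monoid (ring_on A))"
  proof (rule add.subgroupI)
    fix x assume x: "x \<in> J"
    \<comment> \<open>Multiplication by \<open>-1\<close> supplies the additive inverses that a
      subgroup requires.\<close>
    then have "x \<in> A" "- x \<in> A" "- x \<in> J" using assms mult[of "-1" x] by auto
    then have "\<ominus>\<^bsub>ring_on A\<^esub> x = - x"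
      by (intro minus_equality) (auto simp: ring_on_def)
    then show "\<ominus>\<^bsub>ring_on A\<^esub> x \<in> J" using \<open>- x \<in> J\<close> by simp
  qed (use assms in \<open>auto simp: ring_on_def\<close>)
  show "x \<otimes>\<^bsub>ring_on A\<^esub> a \<in> J" if "a \<in> J" "x \<in> carrier (ring_on A)" for a x
    using mult that by (simp add: ring_on_def)
  show "a \<otimes>\<^bsub>ring_on A\<^esub> x \<in> J" if "a \<in> J" "x \<in> carrier (ring_on A)" for a x
    using mult[of x a] that by (simp add: ring_on_def mult.commute[of a x])
qed (rule assms)

lemma ideal_ring_onD:
  assumes "ideal J (ring_on A)"
  shows "J \<subseteq> A" "0 \<in> J" "\<And>x y. x \<in> J \<Longrightarrow> y \<in> J \<Longrightarrow> x + y \<in> J"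
    "\<And>x y. x \<in> A \<Longrightarrow> y \<in> J \<Longrightarrow> x * y \<in> J"
proof -
  interpret ideal J "ring_on A" by fact
  show "J \<subseteq> A" using a_subset by (simp add: ring_on_def)
  show "0 \<in> J" using additive_subgroup.zero_closed[OF additive_subgroup_axioms] by (simp add: ring_on_def)
  show "\<And>x y. x \<in> J \<Longrightarrow> y \<in> J \<Longrightarrow> x + y \<in> J" using additive_subgroup.a_closed[OF additive_subgroup_axioms] by (simp add: ring_on_def)
  show "\<And>x y. x \<in> A \<Longrightarrow> y \<in> J \<Longrightarrow> x * y \<in> J" using I_l_closed by (simp add: ring_on_def)
qed

lemma ring_ring_on_UNIV: "ring (ring_on UNIV)"
  by (rule ring_ring_on) auto

lemma ideal_gen_ideal: "ideal (ideal_gen G) (ring_on UNIV)"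
  by (rule ring.genideal_ideal[OF ring_ring_on_UNIV]) (auto simp: ring_on_def)

lemma ideal_gen_subset: "G \<subseteq> ideal_gen G"
  by (rule ring.genideal_self[OF ring_ring_on_UNIV]) (auto simp: ring_on_def)

lemma ideal_gen_least: "ideal J (ring_on UNIV) \<Longrightarrow> G \<subseteq> J \<Longrightarrow> ideal_gen G \<subseteq> J"
  by (rule ring.genideal_minimal[OF ring_ring_on_UNIV])

section \<open>Monomial ideals\<close>

text \<open>The polynomials whose monomials are all multiples of monomials from \<open>B\<close>
  form an ideal \<open>?J\<close> containing the generators.\<close>

lemma monomial_in_ideal_gen:
  assumes "(monomial_of a :: ('x, 'k::comm_ring_1) mpoly) \<in> ideal_gen (monomial_of ` B)"
  shows "\<exists>b\<in>B. \<exists>c. a = c + b"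
proof -
  let ?J = "{p :: ('x, 'k) mpoly. \<forall>m\<in>Poly_Mapping.keys p. \<exists>b\<in>B. \<exists>c. m = c + b}"
  have "ideal ?J (ring_on UNIV)"
  proof (rule ideal_ring_onI[OF ring_ring_on_UNIV])
    fix x y :: "('x, 'k) mpoly"
    show "x + y \<in> ?J" if "x \<in> ?J" "y \<in> ?J"
      using that keys_add[of x y] by blast
    show "x * y \<in> ?J" if y: "y \<in> ?J"
    proof (standard, standard)
      fix m assume "m \<in> Poly_Mapping.keys (x * y)"
      then obtain u v where "m = u + v" "v \<in> Poly_Mapping.keys y" using keys_mult by blast
      moreover then obtain b c where "b \<in> B" "v = c + b" using y by blast
      ultimately show "\<exists>b\<in>B. \<exists>c. m = c + b" by (metis add.assoc)
    qed
  qed auto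
  moreover have "monomial_of ` B \<subseteq> ?J"
    by (auto simp: monomial_of_def) (metis add_0)
  ultimately have "monomial_of a \<in> ?J" using ideal_gen_least assms by blast
  then show ?thesis by (simp add: monomial_of_def)
qed

lemma monomial_of_add: "monomial_of (a + b) = monomial_of a * (monomial_of b :: ('x, 'k::comm_ring_1) mpoly)"
  by (simp add: monomial_of_def mult_single)

text \<open>A generator divisible by a different one is redundant: the ideal of the remaining
  generators \<open>?H\<close> already contains it, against minimality.\<close>

lemma minimal_monomial_generators_divides:
  assumes f: "minimal_monomial_generators (I :: ('x, 'k::comm_ring_1) mpoly set) n f"
    and e: "\<And>i. i < n \<Longrightarrow> f i = monomial_of (e i)"
    and ij: "i < n" "j < n" "e i = c + e j"
  shows "i = j"
proof (rule ccontr)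
  assume "i \<noteq> j"
  have inj: "inj_on f {..<n}" and I: "ideal_gen (f ` {..<n}) = I"
    and min: "\<And>H. H \<subset> f ` {..<n} \<Longrightarrow> ideal_gen H \<noteq> I"
    using f unfolding minimal_monomial_generators_def by simp_all
  let ?H = "f ` {..<n} - {f i}"
  have "f j \<in> ?H" using inj ij \<open>i \<noteq> j\<close> by (auto simp: inj_on_def)
  then have "monomial_of c * f j \<in> ideal_gen ?H"
    using ideal_gen_subset[of ?H] by (intro ideal_ring_onD(4)[OF ideal_gen_ideal]) auto
  then have "f i \<in> ideal_gen ?H"
    using ij by (simp add: e monomial_of_add)
  then have "f k \<in> ideal_gen ?H" if "k < n" for k
    using ideal_gen_subset[of ?H] that by (cases "f k = f i") auto
  then have "f ` {..<n} \<subseteq> ideal_gen ?H" by blast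
  then have "ideal_gen (f ` {..<n}) \<subseteq> ideal_gen ?H"
    by (intro ideal_gen_least ideal_gen_ideal)
  moreover have "ideal_gen ?H \<subseteq> ideal_gen (f ` {..<n})"
    by (intro ideal_gen_least ideal_gen_ideal subset_trans[OF Diff_subset ideal_gen_subset])
  ultimately have "ideal_gen ?H = I" using I by simp
  moreover have "?H \<subset> f ` {..<n}" using \<open>i < n\<close> by blast
  ultimately show False using min by simp
qed

text \<open>Square-freeness is assumed of some generating set \<open>A\<close>, not of
  \<open>f\<close>. Dividing back and forth transfers it: \<open>e i\<close> is a multiple of some
  \<open>a\<close> in \<open>A\<close>, and \<open>a\<close> of some \<open>e j\<close>; minimality
  gives \<open>i = j\<close>, so \<open>f i\<close> divides a square-free monomial.\<close>

lemma squarefree_minimal_generator: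
  assumes I: "squarefree_monomial_ideal (I :: ('x, 'k::comm_ring_1) mpoly set)"
    and f: "minimal_monomial_generators I n f"
    and e: "\<And>i. i < n \<Longrightarrow> f i = monomial_of (e i)"
    and "i < n"
  shows "Poly_Mapping.lookup (e i) x \<le> 1"
proof -
  obtain A where A: "\<And>a x. a \<in> A \<Longrightarrow> Poly_Mapping.lookup a x \<le> 1" and IA: "I = ideal_gen (monomial_of ` A)"
    using I by (auto simp: squarefree_monomial_ideal_def)
  have If: "I = ideal_gen (monomial_of ` e ` {..<n})"
  proof -
    have "f ` {..<n} = monomial_of ` e ` {..<n}" by (auto simp: e intro!: image_eqI)
    moreover have "ideal_gen (f ` {..<n}) = I" using f by (simp add: minimal_monomial_generators_def)
    ultimately show ?thesis by simp
  qed
  have "monomial_of (e i) \<in> I"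
    unfolding If by (rule subsetD[OF ideal_gen_subset]) (use \<open>i < n\<close> in blast)
  then have "\<exists>a\<in>A. \<exists>c. e i = c + a" unfolding IA by (rule monomial_in_ideal_gen)
  then obtain a c where a: "a \<in> A" "e i = c + a" by blast
  then have "monomial_of a \<in> I"
    unfolding IA by (intro subsetD[OF ideal_gen_subset]) blast
  then have "\<exists>b\<in>e ` {..<n}. \<exists>c. a = c + b" unfolding If by (rule monomial_in_ideal_gen)
  then obtain j d where j: "j < n" "a = d + e j" by blast
  then have "e i = (c + d) + e j" using a by (simp add: add.assoc)
  then have "i = j" by (intro minimal_monomial_generators_divides[OF f e \<open>i < n\<close> j(1)])
  with j have "Poly_Mapping.lookup (e i) x \<le> Poly_Mapping.lookup a x" by (simp add: lookup_add)
  then show ?thesis using A[OF a(1), of x] by simp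
qed

text \<open>The shared variable is a common divisor and not a unit.\<close>

lemma not_gcd_is_one_if_common_variable:
  assumes "Poly_Mapping.lookup a x \<noteq> 0" "Poly_Mapping.lookup b x \<noteq> 0"
  shows "\<not> gcd_is_one (monomial_of a) (monomial_of b :: ('x, 'k::comm_ring_1) mpoly)"
proof
  let ?e = "Poly_Mapping.single x (1::nat)"
  assume gcd: "gcd_is_one (monomial_of a) (monomial_of b :: ('x, 'k) mpoly)"
  have "monomial_of ?e dvd (monomial_of c :: ('x, 'k) mpoly)" if "Poly_Mapping.lookup c x \<noteq> 0" for c
  proof -
    have "c = ?e + (c - ?e)"
      using that by (intro poly_mapping_eqI) (auto simp: lookup_add lookup_minus lookup_single when_def)
    then show ?thesis by (metis dvd_triv_left monomial_of_add)
  qed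
  then have "monomial_of ?e dvd (1 :: ('x, 'k) mpoly)"
    using gcd assms by (auto simp: gcd_is_one_def)
  then obtain q where q: "1 = monomial_of ?e * (q :: ('x, 'k) mpoly)" by (rule dvdE)
  \<comment> \<open>All monomials of a multiple of the variable have positive exponent at
    \<open>x\<close>, whereas the monomial of \<open>1\<close> has exponent
    \<open>0\<close>.\<close>
  have "0 \<in> Poly_Mapping.keys (monomial_of ?e * q)" unfolding q[symmetric] by simp
  then obtain u where "0 = ?e + u"
    using keys_mult[of "monomial_of ?e" q] by (auto simp: monomial_of_def)
  then have "Poly_Mapping.lookup 0 x = Poly_Mapping.lookup (?e + u) x" by simp
  then show False by (simp add: lookup_add)
qed

section \<open>The relations of the Rees algebra\<close>

lemma rees_map_single:
  "rees_map n f (Poly_Mapping.single m r) = [:r:] * (\<Prod>i<n. [:0, f i:] ^ Poly_Mapping.lookup m i)"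
  by (cases "r = 0") (simp_all add: rees_map_def)

lemma rees_map_0: "rees_map n f 0 = 0"
  by (simp add: rees_map_def)

lemma rees_map_add: "rees_map n f (p + q) = rees_map n f p + rees_map n f q"
proof -
  have "[:r + s:] * c = [:r:] * c + [:s:] * c" for r s and c :: "'a poly"
    by (simp add: smult_add_left)
  then show ?thesis
    unfolding rees_map_def by (intro setsum_keys_plus_distrib) auto
qed

lemma rees_map_diff: "rees_map n f (p - q) = rees_map n f p - rees_map n f q"
  using rees_map_add[of n f "p - q" q] by (simp add: algebra_simps)

lemma rees_map_sum: "rees_map n f (sum g A) = (\<Sum>x\<in>A. rees_map n f (g x))"
  by (induction A rule: infinite_finite_induct) (simp_all add: rees_map_0 rees_map_add)

text \<open>On single terms exponents add; bilinearity extends this to all polynomials.\<close>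

lemma rees_map_mult: "rees_map n f (p * q) = rees_map n f p * rees_map n f q"
proof -
  have single: "rees_map n f (Poly_Mapping.single m r * Poly_Mapping.single m' r') =
      rees_map n f (Poly_Mapping.single m r) * rees_map n f (Poly_Mapping.single m' r')" for m m' r r'
    by (simp add: mult_single rees_map_single lookup_add power_add prod.distrib mult.commute)
  let ?s = "\<lambda>p. \<Sum>m\<in>Poly_Mapping.keys p. Poly_Mapping.single m (Poly_Mapping.lookup p m)"
  have "rees_map n f (?s p * ?s q) = rees_map n f (?s p) * rees_map n f (?s q)"
    unfolding sum_product rees_map_sum single ..
  then show ?thesis by (simp flip: poly_mapping_eq_sum_single)
qed

section \<open>The ring S and the kernel J\<close>

lemma carrier_rees_source:
  "carrier (rees_source n) = {p. \<forall>m\<in>Poly_Mapping.keys p. Poly_Mapping.keys m \<subseteq> {..<n}}"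
  by (simp add: rees_source_def ring_on_def)

lemma rees_source_eq: "rees_source n = ring_on (carrier (rees_source n))"
  by (simp add: rees_source_def ring_on_def)

lemma rees_source_uminus: "p \<in> carrier (rees_source n) \<Longrightarrow> - p \<in> carrier (rees_source n)"
  by (auto simp: carrier_rees_source in_keys_iff)

lemma ring_rees_source: "ring (rees_source n :: (nat, 'r::comm_ring_1) mpoly ring)"
proof (subst rees_source_eq, rule ring_ring_on)
  fix p q :: "(nat, 'r) mpoly"
  assume pq: "p \<in> carrier (rees_source n)" "q \<in> carrier (rees_source n)"
  show "p + q \<in> carrier (rees_source n)"
    using pq keys_add[of p q] by (fastforce simp: carrier_rees_source)
  show "p * q \<in> carrier (rees_source n)"
    unfolding carrier_rees_source
  proof (standard, standard)
    fix m assume "m \<in> Poly_Mapping.keys (p * q)"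
    then obtain a b where "m = a + b" "a \<in> Poly_Mapping.keys p" "b \<in> Poly_Mapping.keys q"
      using keys_mult by blast
    then show "Poly_Mapping.keys m \<subseteq> {..<n}"
      using pq keys_add[of a b] by (fastforce simp: carrier_rees_source)
  qed
qed (auto simp: rees_source_uminus carrier_rees_source)

lemma rees_relations_eq:
  "rees_relations I n f = {p \<in> carrier (rees_source n). rees_map n f p = 0}"
  by (simp add: rees_relations_def a_kernel_def' rees_algebra_def ring_on_def)

lemma ideal_rees_relations:
  fixes f :: "nat \<Rightarrow> 'r::comm_ring_1"
  shows "ideal (rees_relations I n f) (rees_source n)"
proof -
  let ?S = "carrier (rees_source n :: (nat, 'r) mpoly ring)"
  interpret ring "rees_source n :: (nat, 'r) mpoly ring" by (rule ring_rees_source)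
  have "ideal (rees_relations I n f) (ring_on ?S)"
  proof (rule ideal_ring_onI)
    show "ring (ring_on ?S)" using ring_rees_source by (simp flip: rees_source_eq)
    show "- 1 \<in> ?S" by (rule rees_source_uminus) (simp add: carrier_rees_source)
    have "p + q \<in> ?S" "p * q \<in> ?S" if "p \<in> ?S" "q \<in> ?S" for p q
      using a_closed[OF that] m_closed[OF that] by (simp_all add: rees_source_def ring_on_def)
    note S = this
    show "p + q \<in> rees_relations I n f" if "p \<in> rees_relations I n f" "q \<in> rees_relations I n f" for p q
      using that S by (simp add: rees_relations_eq rees_map_add)
    show "p * q \<in> rees_relations I n f" if "p \<in> ?S" "q \<in> rees_relations I n f" for p q
      using that S by (simp add: rees_relations_eq rees_map_mult)
  qed (auto simp: rees_relations_eq rees_map_0 carrier_rees_source)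
  then show ?thesis by (simp flip: rees_source_eq)
qed

text \<open>The kernel is an ideal, so it contains the ideal generated by its linear part; the
  content is the other inclusion. With \<open>K\<close> arbitrary, what follows works only with
  closure properties and the linear relations in \<open>K\<close>.\<close>

lemma linear_typeI:
  assumes "\<And>K. ideal K (rees_source n) \<Longrightarrow> rees_relations I n f \<inter> linear_forms n \<subseteq> K
             \<Longrightarrow> rees_relations I n f \<subseteq> K"
  shows "linear_type I n f"
proof -
  interpret ring "rees_source n" by (rule ring_rees_source)
  have sub: "rees_relations I n f \<inter> linear_forms n \<subseteq> carrier (rees_source n)"
    by (auto simp: rees_relations_eq)
  show ?thesis
    unfolding linear_type_def
    by (intro equalityI assms genideal_ideal genideal_self genideal_minimal sub
        ideal_rees_relations Int_lower1)
qed

section \<open>Binomial relations\<close>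

text \<open>The exponent vector of the product of the f_i^(m_i); the inner sum is the multiple of
  \<open>e i\<close> by \<open>lookup m i\<close>.\<close>

definition exponent :: "nat \<Rightarrow> (nat \<Rightarrow> 'x \<Rightarrow>\<^sub>0 nat) \<Rightarrow> (nat \<Rightarrow>\<^sub>0 nat) \<Rightarrow> 'x \<Rightarrow>\<^sub>0 nat" where
  "exponent n e m = (\<Sum>i<n. \<Sum>j<Poly_Mapping.lookup m i. e i)"

definition total_degree :: "nat \<Rightarrow> (nat \<Rightarrow>\<^sub>0 nat) \<Rightarrow> nat" where
  "total_degree n m = (\<Sum>i<n. Poly_Mapping.lookup m i)"

text \<open>The term c x^a T^m of S. Coefficients of S are polynomials in x, hence the nested
  \<open>single\<close>.\<close>

abbreviation term_of :: "('x \<Rightarrow>\<^sub>0 nat) \<Rightarrow> (nat \<Rightarrow>\<^sub>0 nat) \<Rightarrow> 'k \<Rightarrow> (nat, ('x, 'k::comm_ring_1) mpoly) mpoly" where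
  "term_of a m c \<equiv> Poly_Mapping.single m (Poly_Mapping.single a c)"

lemma lookup_exponent:
  "Poly_Mapping.lookup (exponent n e m) x = (\<Sum>i<n. Poly_Mapping.lookup m i * Poly_Mapping.lookup (e i) x)"
  by (simp add: exponent_def lookup_sum)

lemma exponent_add: "exponent n e (m + m') = exponent n e m + exponent n e m'"
  by (rule poly_mapping_eqI) (simp add: lookup_exponent lookup_add distrib_right sum.distrib)

lemma exponent_single: "i < n \<Longrightarrow> exponent n e (Poly_Mapping.single i 1) = e i"
  by (rule poly_mapping_eqI)
    (simp add: lookup_exponent lookup_single when_def if_distrib[of "\<lambda>c. c * _"] cong: if_cong)

lemma total_degree_add: "total_degree n (m + m') = total_degree n m + total_degree n m'"
  by (simp add: total_degree_def lookup_add sum.distrib)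

lemma total_degree_single: "i < n \<Longrightarrow> total_degree n (Poly_Mapping.single i 1) = 1"
  by (simp add: total_degree_def lookup_single when_def)

lemma total_degree_eq_0:
  assumes "total_degree n m = 0" "Poly_Mapping.keys m \<subseteq> {..<n}"
  shows "m = 0"
proof (rule poly_mapping_eqI)
  fix k
  show "Poly_Mapping.lookup m k = Poly_Mapping.lookup 0 k"
    using assms by (cases "k < n") (auto simp: total_degree_def in_keys_iff subset_iff)
qed

text \<open>As the f_i are monomials, terms map to terms. The kernel is therefore controlled by
  which pairs (a, m) share both the exponent in x and the degree in t.\<close>

lemma rees_map_term:
  fixes f :: "nat \<Rightarrow> ('x, 'k::comm_ring_1) mpoly"
  assumes f: "\<And>i. i < n \<Longrightarrow> f i = monomial_of (e i)"
  shows "rees_map n f (term_of a m c) = Polynomial.monom (Poly_Mapping.single (a + exponent n e m) c) (total_degree n m)"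
proof -
  have pow: "[:0, monomial_of b:] ^ k = Polynomial.monom (monomial_of (\<Sum>j<k. b) :: ('x, 'k) mpoly) k" for b :: "'x \<Rightarrow>\<^sub>0 nat" and k
  proof (induction k)
    case 0 show ?case by (simp add: monomial_of_def monom_0 one_pCons)
  next
    case (Suc k)
    have "[:0, monomial_of b :: ('x, 'k) mpoly:] = Polynomial.monom (monomial_of b) 1" by (simp add: monom_altdef)
    then show ?case using Suc by (simp add: mult_monom add.commute flip: monomial_of_add)
  qed
  \<comment> \<open>The bound \<open>N \<le> n\<close> keeps the induction where \<open>f\<close> is
    known to be monomial.\<close>
  have "N \<le> n \<Longrightarrow> (\<Prod>i<N. [:0, f i:] ^ Poly_Mapping.lookup m i) =
      Polynomial.monom (monomial_of (exponent N e m)) (total_degree N m)" for N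
  proof (induction N)
    case 0 show ?case by (simp add: exponent_def total_degree_def monomial_of_def monom_0 one_pCons)
  next
    case (Suc N)
    then show ?case
      by (simp add: f pow mult_monom exponent_def total_degree_def flip: monomial_of_add)
  qed
  then show ?thesis
    by (simp add: rees_map_single smult_monom monomial_of_def mult_single)
qed

section \<open>Linear binomials and lowering the degree\<close>

lemma remove_key:
  fixes u :: "'a \<Rightarrow>\<^sub>0 nat"
  assumes "k \<in> Poly_Mapping.keys u"
  obtains u' where "u = u' + Poly_Mapping.single k 1" "Poly_Mapping.keys u' \<subseteq> Poly_Mapping.keys u"
proof
  show "u = (u - Poly_Mapping.single k 1) + Poly_Mapping.single k 1"
    using assms by (intro poly_mapping_eqI) (auto simp: lookup_add lookup_minus lookup_single when_def in_keys_iff)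
  show "Poly_Mapping.keys (u - Poly_Mapping.single k 1) \<subseteq> Poly_Mapping.keys u"
    by (auto simp: in_keys_iff lookup_minus)
qed

lemma linear_binomial_relation:
  fixes f :: "nat \<Rightarrow> ('x, 'k::comm_ring_1) mpoly"
  assumes f: "\<And>i. i < n \<Longrightarrow> f i = monomial_of (e i)"
    and ij: "i < n" "j < n" "a + e i = b + e j"
  shows "term_of a (Poly_Mapping.single i 1) 1 - term_of b (Poly_Mapping.single j 1) 1
           \<in> rees_relations I n f \<inter> linear_forms n"
proof -
  let ?p = "term_of a (Poly_Mapping.single i 1) 1 :: (nat, ('x, 'k) mpoly) mpoly"
  let ?q = "term_of b (Poly_Mapping.single j 1) 1 :: (nat, ('x, 'k) mpoly) mpoly"
  \<comment> \<open>Only an inclusion, because the two terms cancel when they coincide.\<close>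
  have keys: "Poly_Mapping.keys (?p - ?q) \<subseteq> {Poly_Mapping.single i 1, Poly_Mapping.single j 1}"
    by (auto simp: in_keys_iff lookup_minus lookup_single when_def split: if_splits)
  then have S: "?p - ?q \<in> carrier (rees_source n)"
    using ij by (force simp: carrier_rees_source)
  moreover have "rees_map n f (?p - ?q) = 0"
  proof -
    have "rees_map n f ?p = rees_map n f ?q"
      using ij rees_map_term[of n f e, OF f]
      by (simp only: exponent_single total_degree_single)
    then show ?thesis by (simp add: rees_map_diff)
  qed
  moreover have "(\<Sum>i<n. Poly_Mapping.lookup m i) = 1" if "m \<in> Poly_Mapping.keys (?p - ?q)" for m
    using keys that total_degree_single ij unfolding total_degree_def by blast
  ultimately show ?thesis by (simp add: rees_relations_eq linear_forms_def)
qed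

text \<open>Induction on the common degree. The hypothesis \<open>exchange\<close> isolates the
  combinatorics: for disjoint supports it provides a linear relation after which both terms share a
  variable, and cancelling that variable lowers the degree.\<close>

lemma binomial_in_linear_ideal:
  fixes f :: "nat \<Rightarrow> ('x, 'k::comm_ring_1) mpoly"
  assumes f: "\<And>i. i < n \<Longrightarrow> f i = monomial_of (e i)"
    and K: "ideal K (rees_source n)" and lin: "rees_relations I n f \<inter> linear_forms n \<subseteq> K"
    and exchange: "\<And>a b u v. \<lbrakk>Poly_Mapping.keys u \<subseteq> {..<n}; Poly_Mapping.keys v \<subseteq> {..<n};
        Poly_Mapping.keys u \<inter> Poly_Mapping.keys v = {}; u \<noteq> 0; v \<noteq> 0;
        a + exponent n e u = b + exponent n e v\<rbrakk> \<Longrightarrow>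
        \<exists>i\<in>Poly_Mapping.keys u. \<exists>j\<in>Poly_Mapping.keys v. (\<exists>c. a + e i = c + e j) \<or> (\<exists>c. b + e j = c + e i)"
    and uv: "Poly_Mapping.keys u \<subseteq> {..<n}" "Poly_Mapping.keys v \<subseteq> {..<n}"
      "a + exponent n e u = b + exponent n e v" "total_degree n u = total_degree n v"
  shows "term_of a u 1 - term_of b v 1 \<in> K"
  using uv
proof (induction "total_degree n u" arbitrary: a b u v)
  case 0
  then have "u = 0" "v = 0" using total_degree_eq_0[of n] by auto
  with 0 have "a = b" by simp
  then show ?case using \<open>u = 0\<close> \<open>v = 0\<close> ideal_ring_onD(2)[OF K[unfolded rees_source_def]] by simp
next
  case (Suc d)
  have Kadd: "p + q \<in> K" if "p \<in> K" "q \<in> K" for p q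
    using ideal_ring_onD(3)[OF K[unfolded rees_source_def]] that by blast
  have Kmult: "term_of 0 m 1 * q \<in> K" if "Poly_Mapping.keys m \<subseteq> {..<n}" "q \<in> K" for m q
    using ideal_ring_onD(4)[OF K[unfolded rees_source_def], of "term_of 0 m 1" q] that by simp
  \<comment> \<open>Stated for arbitrary binomials of degree \<open>Suc d\<close>, since it is also
    applied after an exchange has changed one term. The shared variable is cancelled, the induction
    hypothesis applied, and the variable multiplied back.\<close>
  have common: "term_of a u 1 - term_of b v 1 \<in> K"
    if u: "Poly_Mapping.keys u \<subseteq> {..<n}" and v: "Poly_Mapping.keys v \<subseteq> {..<n}"
      and eq: "a + exponent n e u = b + exponent n e v" and du: "total_degree n u = Suc d"
      and dv: "total_degree n v = Suc d" and k: "k \<in> Poly_Mapping.keys u" "k \<in> Poly_Mapping.keys v"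
    for a b u v k
  proof -
    let ?t = "Poly_Mapping.single k 1"
    have "k < n" using k u by auto
    obtain u' where u': "u = u' + ?t" "Poly_Mapping.keys u' \<subseteq> Poly_Mapping.keys u" by (rule remove_key[OF k(1)])
    obtain v' where v': "v = v' + ?t" "Poly_Mapping.keys v' \<subseteq> Poly_Mapping.keys v" by (rule remove_key[OF k(2)])
    have "(a + exponent n e u') + e k = (b + exponent n e v') + e k"
      using eq unfolding u' v' exponent_add exponent_single[OF \<open>k < n\<close>] by (simp only: add.assoc)
    then have "a + exponent n e u' = b + exponent n e v'" by simp
    moreover have "d = total_degree n u'" "total_degree n u' = total_degree n v'"
      using du dv unfolding u' v' total_degree_add total_degree_single[OF \<open>k < n\<close>] by auto
    ultimately have "term_of a u' 1 - term_of b v' 1 \<in> K"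
      using Suc.hyps(1)[of u' v' a b] u v u'(2) v'(2) by blast
    then have "term_of 0 ?t 1 * (term_of a u' 1 - term_of b v' 1) \<in> K"
      using \<open>k < n\<close> by (intro Kmult) auto
    then show ?thesis unfolding u'(1) v'(1) by (simp add: right_diff_distrib mult_single add.commute)
  qed
  have exch: "term_of a (w + Poly_Mapping.single i 1) 1 - term_of c (w + Poly_Mapping.single j 1) 1 \<in> K"
    if "i < n" "j < n" "a + e i = c + e j" "Poly_Mapping.keys w \<subseteq> {..<n}" for a c w i j
  proof -
    have "term_of 0 w 1 * (term_of a (Poly_Mapping.single i 1) 1 - term_of c (Poly_Mapping.single j 1) 1) \<in> K"
      using linear_binomial_relation[of n f e, OF f] that lin by (intro Kmult) blast+
    then show ?thesis by (simp add: right_diff_distrib mult_single)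
  qed
  have du: "total_degree n u = Suc d" and dv: "total_degree n v = Suc d" using Suc by auto
  have u0: "u \<noteq> 0" and v0: "v \<noteq> 0" using du dv by (auto simp: total_degree_def)
  show ?case
  proof (cases "Poly_Mapping.keys u \<inter> Poly_Mapping.keys v = {}")
    case False
    then show ?thesis using common[OF Suc.prems(1-3) du dv] by blast
  next
    case True
    then obtain i j where i: "i \<in> Poly_Mapping.keys u" and j: "j \<in> Poly_Mapping.keys v"
      and "(\<exists>c. a + e i = c + e j) \<or> (\<exists>c. b + e j = c + e i)"
      using exchange[OF Suc.prems(1,2) True u0 v0 Suc.prems(3)] by blast
    have ij: "i < n" "j < n" using i j Suc.prems by auto
    from \<open>_ \<or> _\<close> show ?thesis
    proof (elim disjE exE)
      fix c assume c: "a + e i = c + e j"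
      obtain w where w: "u = w + Poly_Mapping.single i 1" "Poly_Mapping.keys w \<subseteq> Poly_Mapping.keys u"
        by (rule remove_key[OF i])
      let ?u = "w + Poly_Mapping.single j 1"
      have keys: "Poly_Mapping.keys w \<subseteq> {..<n}" using w Suc.prems by blast
      \<comment> \<open>Telescoping through x^c T^\<open>?u\<close>: the first difference is a
        multiple of a linear relation, the second has the variable with index \<open>j\<close> in
        both terms.\<close>
      have 1: "term_of a u 1 - term_of c ?u 1 \<in> K" unfolding w(1) by (rule exch[OF ij c keys])
      have 2: "term_of c ?u 1 - term_of b v 1 \<in> K"
      proof (rule common[OF _ Suc.prems(2) _ _ dv _ j])
        show "Poly_Mapping.keys ?u \<subseteq> {..<n}" using keys keys_add[of w "Poly_Mapping.single j 1"] ij by auto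
        show "c + exponent n e ?u = b + exponent n e v"
        proof -
          have "c + (exponent n e w + e j) = exponent n e w + (c + e j)" by (simp only: ac_simps)
          also have "\<dots> = a + (exponent n e w + e i)" unfolding c[symmetric] by (simp only: ac_simps)
          finally show ?thesis
            using Suc.prems(3) unfolding w(1) exponent_add exponent_single[OF ij(1)] exponent_single[OF ij(2)] by simp
        qed
        show "total_degree n ?u = Suc d"
          using du ij unfolding w(1) total_degree_add by (simp only: total_degree_single)
        show "j \<in> Poly_Mapping.keys ?u" by (simp add: in_keys_iff lookup_add)
      qed
      show ?thesis using Kadd[OF 1 2] by simp
    next
      fix c assume c: "b + e j = c + e i"
      obtain w where w: "v = w + Poly_Mapping.single j 1" "Poly_Mapping.keys w \<subseteq> Poly_Mapping.keys v"
        by (rule remove_key[OF j])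
      let ?v = "w + Poly_Mapping.single i 1"
      have keys: "Poly_Mapping.keys w \<subseteq> {..<n}" using w Suc.prems by blast
      \<comment> \<open>Mirror image: the exchange takes place in \<open>v\<close>, and the variable
        with index \<open>i\<close> becomes common.\<close>
      have 1: "term_of c ?v 1 - term_of b v 1 \<in> K" unfolding w(1) by (rule exch[OF ij c[symmetric] keys])
      have 2: "term_of a u 1 - term_of c ?v 1 \<in> K"
      proof (rule common[OF Suc.prems(1) _ _ du _ i])
        show "Poly_Mapping.keys ?v \<subseteq> {..<n}" using keys keys_add[of w "Poly_Mapping.single i 1"] ij by auto
        show "a + exponent n e u = c + exponent n e ?v"
        proof -
          have "c + (exponent n e w + e i) = exponent n e w + (c + e i)" by (simp only: ac_simps)
          also have "\<dots> = b + (exponent n e w + e j)" unfolding c[symmetric] by (simp only: ac_simps)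
          finally show ?thesis
            using Suc.prems(3) unfolding w(1) exponent_add exponent_single[OF ij(1)] exponent_single[OF ij(2)] by simp
        qed
        show "total_degree n ?v = Suc d"
          using dv ij unfolding w(1) total_degree_add by (simp only: total_degree_single)
        show "i \<in> Poly_Mapping.keys ?v" by (simp add: in_keys_iff lookup_add)
      qed
      show ?thesis using Kadd[OF 2 1] by simp
    qed
  qed
qed

text \<open>Each term of a relation is replaced by a representative of its fibre under the map \<open>g\<close> to
  the monomials of \<open>R[t]\<close>: this changes the relation by an element of \<open>K\<close> and turns it into \<open>0\<close>.\<close>

lemma rees_relations_subset_if_binomials:
  fixes f :: "nat \<Rightarrow> ('x, 'k::comm_ring_1) mpoly"
  assumes f: "\<And>i. i < n \<Longrightarrow> f i = monomial_of (e i)"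
    and K: "ideal K (rees_source n)"
    and binomial: "\<And>a b u v. \<lbrakk>Poly_Mapping.keys u \<subseteq> {..<n}; Poly_Mapping.keys v \<subseteq> {..<n};
        a + exponent n e u = b + exponent n e v; total_degree n u = total_degree n v\<rbrakk> \<Longrightarrow>
        term_of a u 1 - term_of b v 1 \<in> K"
  shows "rees_relations I n f \<subseteq> K"
proof
  fix p assume "p \<in> rees_relations I n f"
  then have pS: "\<And>m. m \<in> Poly_Mapping.keys p \<Longrightarrow> Poly_Mapping.keys m \<subseteq> {..<n}"
    and p0: "rees_map n f p = 0"
    by (auto simp: rees_relations_eq carrier_rees_source)
  \<comment> \<open>\<open>Q\<close> indexes the terms of \<open>p\<close> by pairs (m, a) of
    exponents in T and in x; \<open>c\<close> gives the scalar coefficient, \<open>t\<close> the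
    term with free coefficient, and \<open>g\<close> the exponents of its image in x and t.\<close>
  define Q where "Q = (SIGMA m:Poly_Mapping.keys p. Poly_Mapping.keys (Poly_Mapping.lookup p m))"
  define c where "c q = Poly_Mapping.lookup (Poly_Mapping.lookup p (fst q)) (snd q)" for q
  define t where "t q = (term_of (snd q :: 'x \<Rightarrow>\<^sub>0 nat) (fst q) :: 'k \<Rightarrow> _)" for q
  define g where "g q = (snd q + exponent n e (fst q), total_degree n (fst q))" for q
  define rep where "rep z = (SOME q. q \<in> Q \<and> g q = z)" for z
  have finQ: "finite Q" by (simp add: Q_def)
  have rep: "rep (g q) \<in> Q \<and> g (rep (g q)) = g q" if "q \<in> Q" for q
    unfolding rep_def using that by (intro someI) auto
  have single_sum: "Poly_Mapping.single m (sum h A) = (\<Sum>x\<in>A. Poly_Mapping.single m (h x))"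
    for m :: "'z" and h :: "'y \<Rightarrow> 'w::comm_monoid_add" and A
    by (induction A rule: infinite_finite_induct) (simp_all add: single_add)
  have "p = (\<Sum>m\<in>Poly_Mapping.keys p. \<Sum>a\<in>Poly_Mapping.keys (Poly_Mapping.lookup p m).
              term_of a m (Poly_Mapping.lookup (Poly_Mapping.lookup p m) a))"
    by (simp flip: single_sum poly_mapping_eq_sum_single)
  also have "\<dots> = (\<Sum>q\<in>Q. t q (c q))"
    unfolding Q_def t_def c_def by (subst sum.Sigma) (auto simp: case_prod_unfold)
  finally have p: "p = (\<Sum>q\<in>Q. t q (c q))" .
  have img: "(\<Sum>q\<in>Q. Polynomial.monom (Poly_Mapping.single (fst (g q)) (c q)) (snd (g q))) = 0"
    using p0 rees_map_term[of n f e, OF f] unfolding p rees_map_sum t_def g_def by simp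
  \<comment> \<open>The sum over a fibre is one coefficient of the image of \<open>p\<close>, which
    is zero.\<close>
  have fibre: "(\<Sum>q\<in>{q \<in> Q. g q = z}. c q) = 0" for z
  proof -
    have "0 = Poly_Mapping.lookup (Polynomial.coeff (\<Sum>q\<in>Q. Polynomial.monom (Poly_Mapping.single (fst (g q)) (c q)) (snd (g q))) (snd z)) (fst z)"
      unfolding img by simp
    also have "\<dots> = (\<Sum>q\<in>Q. if g q = z then c q else 0)"
      unfolding coeff_sum lookup_sum
      by (intro sum.cong) (auto simp: lookup_single when_def prod_eq_iff)
    also have "\<dots> = (\<Sum>q\<in>{q \<in> Q. g q = z}. c q)"
      using finQ by (simp add: sum.inter_filter)
    finally show ?thesis by simp
  qed
  \<comment> \<open>Moving all terms of a fibre to its representative adds up their coefficients,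
    and these cancel by \<open>fibre\<close>.\<close>
  have "(\<Sum>q\<in>Q. t (rep (g q)) (c q)) = (\<Sum>z\<in>g ` Q. \<Sum>q\<in>{q \<in> Q. g q = z}. t (rep (g q)) (c q))"
    by (rule sum.image_gen[OF finQ])
  also have "\<dots> = (\<Sum>z\<in>g ` Q. t (rep z) (\<Sum>q\<in>{q \<in> Q. g q = z}. c q))"
    unfolding t_def single_sum by (intro sum.cong) auto
  also have "\<dots> = 0" by (simp add: fibre t_def)
  finally have "p = (\<Sum>q\<in>Q. t q (c q) - t (rep (g q)) (c q))"
    unfolding sum_subtractf p by simp
  moreover have "t q (c q) - t (rep (g q)) (c q) \<in> K" if q: "q \<in> Q" for q
  proof -
    have "t q 1 - t (rep (g q)) 1 \<in> K"
      unfolding t_def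
    proof (rule binomial)
      show "Poly_Mapping.keys (fst q) \<subseteq> {..<n}" "Poly_Mapping.keys (fst (rep (g q))) \<subseteq> {..<n}"
        using q rep[OF q] by (auto simp: Q_def intro!: pS)
      show "snd q + exponent n e (fst q) = snd (rep (g q)) + exponent n e (fst (rep (g q)))"
        "total_degree n (fst q) = total_degree n (fst (rep (g q)))"
        using rep[OF q] unfolding g_def by auto
    qed
    \<comment> \<open>\<open>term_of 0 0 (c q)\<close> is the constant \<open>c q\<close>, which
      scales the binomial with coefficients 1.\<close>
    then have "term_of 0 0 (c q) * (t q 1 - t (rep (g q)) 1) \<in> K"
      by (intro ideal_ring_onD(4)[OF K[unfolded rees_source_def]]) auto
    then show ?thesis by (simp add: t_def right_diff_distrib mult_single)
  qed
  moreover have "sum h A \<in> K" if "\<And>q. q \<in> A \<Longrightarrow> h q \<in> K"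
    for h and A :: "((nat \<Rightarrow>\<^sub>0 nat) \<times> ('x \<Rightarrow>\<^sub>0 nat)) set"
    using that
    by (induction A rule: infinite_finite_induct)
      (auto intro: ideal_ring_onD(2,3)[OF K[unfolded rees_source_def]])
  ultimately show "p \<in> K" by simp
qed

section \<open>Exchange from a leaf\<close>

text \<open>Compare exponents at each variable. Where \<open>e i\<close> is nonzero, square-freeness
  of \<open>e j\<close> suffices. A variable of \<open>e j\<close> outside \<open>e i\<close> occurs
  in no generator indexed by \<open>u\<close>, so its positive exponent on the right of
  \<open>eq\<close> must come from \<open>a\<close>.\<close>

lemma leaf_divides:
  fixes e :: "nat \<Rightarrow> 'x \<Rightarrow>\<^sub>0 nat"
  assumes sqf: "\<And>x. Poly_Mapping.lookup (e j) x \<le> 1"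
    and j: "j < n" "j \<in> Poly_Mapping.keys v"
    and eq: "a + exponent n e u = b + exponent n e v"
    and leaf: "\<And>i'. i' \<in> Poly_Mapping.keys u \<Longrightarrow> i' \<noteq> i \<Longrightarrow>
      \<not> (\<exists>x. Poly_Mapping.lookup (e i') x \<noteq> 0 \<and> Poly_Mapping.lookup (e j) x \<noteq> 0)"
  shows "\<exists>c. a + e i = c + e j"
proof
  have "Poly_Mapping.lookup (e j) x \<le> Poly_Mapping.lookup a x + Poly_Mapping.lookup (e i) x" for x
  proof (cases "Poly_Mapping.lookup (e j) x = 0 \<or> Poly_Mapping.lookup (e i) x \<noteq> 0")
    case True
    then show ?thesis using sqf[of x] by auto
  next
    case False
    have "Poly_Mapping.lookup u k = 0 \<or> Poly_Mapping.lookup (e k) x = 0" for k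
      using leaf[of k] False unfolding in_keys_iff by blast
    then have u0: "Poly_Mapping.lookup (exponent n e u) x = 0"
      by (simp add: lookup_exponent)
    have "1 \<le> Poly_Mapping.lookup v j * Poly_Mapping.lookup (e j) x"
      using False j by (auto simp: in_keys_iff Suc_le_eq)
    also have "\<dots> \<le> Poly_Mapping.lookup (exponent n e v) x"
      unfolding lookup_exponent using j
      by (intro member_le_sum[where f = "\<lambda>k. Poly_Mapping.lookup v k * Poly_Mapping.lookup (e k) x"]) auto
    also have "\<dots> \<le> Poly_Mapping.lookup (b + exponent n e v) x" by (simp add: lookup_add)
    also have "\<dots> = Poly_Mapping.lookup a x" by (simp add: lookup_add u0 flip: eq)
    finally show ?thesis using sqf[of x] by simp
  qed
  \<comment> \<open>The subtraction in the witness is truncated; the inequality just shown makes it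
    exact.\<close>
  then show "a + e i = (a + e i - e j) + e j"
    by (intro poly_mapping_eqI) (simp add: lookup_add lookup_minus)
qed

section \<open>Linear type from the absence of even cycles\<close>

theorem theorem3p4:
  fixes I :: "('x::finite, 'k::field) mpoly set"
    and n :: nat
    and f :: "nat \<Rightarrow> ('x, 'k) mpoly"
  assumes "squarefree_monomial_ideal I"
    and "minimal_monomial_generators I n f"
    and "disjoint_union_of (\<lambda>H. tree H \<or> odd_unicyclic H) (generator_graph n f)"
  shows "linear_type I n f"
proof (rule linear_typeI)
  fix K assume K: "ideal K (rees_source n)" and lin: "rees_relations I n f \<inter> linear_forms n \<subseteq> K"
  have "\<forall>i\<in>{..<n}. \<exists>a. f i = monomial_of a"
    using assms(2) unfolding minimal_monomial_generators_def by blast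
  then obtain e where f: "\<And>i. i < n \<Longrightarrow> f i = monomial_of (e i)" by (auto dest!: bchoice)
  have sqf: "Poly_Mapping.lookup (e i) x \<le> 1" if "i < n" for i x
    by (rule squarefree_minimal_generator[OF assms(1,2) f that])
  \<comment> \<open>\<open>R\<close> is adjacency in the generator graph for distinct indices, but
    it relates \<open>i\<close> to itself whenever \<open>e i\<close> is nonzero; hence the
    inequality demanded along cycles.\<close>
  define R where "R i j \<longleftrightarrow> (\<exists>x. Poly_Mapping.lookup (e i) x \<noteq> 0 \<and> Poly_Mapping.lookup (e j) x \<noteq> 0)" for i j
  have edge: "{i, j} \<in> snd (generator_graph n f)" if "i < n" "j < n" "i \<noteq> j" "R i j" for i j
  proof -
    obtain x where "Poly_Mapping.lookup (e i) x \<noteq> 0" "Poly_Mapping.lookup (e j) x \<noteq> 0"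
      using \<open>R i j\<close> unfolding R_def by blast
    then have "\<not> gcd_is_one (f i) (f j)"
      unfolding f[OF \<open>i < n\<close>] f[OF \<open>j < n\<close>] by (rule not_gcd_is_one_if_common_variable)
    then show ?thesis using that unfolding generator_graph_def by auto
  qed
  have odd: "odd (length vs)"
    if vs: "3 \<le> length vs" "distinct vs" "set vs \<subseteq> {..<n}"
      and adj: "\<forall>i<length vs. vs ! i \<noteq> vs ! (Suc i mod length vs) \<and> R (vs ! i) (vs ! (Suc i mod length vs))"
    for vs
  proof (rule odd_cycle_if_components_tree_or_odd_unicyclic[OF assms(3) vs(1,2)])
    show "set vs \<subseteq> fst (generator_graph n f)" using vs by (simp add: generator_graph_def)
    have "{vs ! i, vs ! (Suc i mod length vs)} \<in> snd (generator_graph n f)" if "i < length vs" for i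
    proof (rule edge)
      have "Suc i mod length vs < length vs" using that by (intro mod_less_divisor) auto
      then show "vs ! i < n" "vs ! (Suc i mod length vs) < n" using vs(3) that by (auto simp: subset_iff)
    qed (use adj that in auto)
    then show "cycle_edges vs \<subseteq> snd (generator_graph n f)" by (auto simp: cycle_edges_def)
  qed
  have exchange: "\<exists>i\<in>Poly_Mapping.keys u. \<exists>j\<in>Poly_Mapping.keys v. (\<exists>c. a + e i = c + e j) \<or> (\<exists>c. b + e j = c + e i)"
    if uv: "Poly_Mapping.keys u \<subseteq> {..<n}" "Poly_Mapping.keys v \<subseteq> {..<n}"
      "Poly_Mapping.keys u \<inter> Poly_Mapping.keys v = {}" "u \<noteq> 0" "v \<noteq> 0"
      and eq: "a + exponent n e u = b + exponent n e v" for a b u v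
  proof -
    \<comment> \<open>The two sides of the bipartite graph are the supports of \<open>u\<close> and
      \<open>v\<close>. An even cycle would be one of the generator graph, excluded by
      \<open>odd\<close>.\<close>
    have "(\<exists>i\<in>Poly_Mapping.keys u. \<exists>j\<in>Poly_Mapping.keys v. \<forall>i'\<in>Poly_Mapping.keys u. i' \<noteq> i \<longrightarrow> \<not> R i' j)
        \<or> (\<exists>i\<in>Poly_Mapping.keys u. \<exists>j\<in>Poly_Mapping.keys v. \<forall>j'\<in>Poly_Mapping.keys v. j' \<noteq> j \<longrightarrow> \<not> R i j')"
    proof (rule bipartite_leaf)
      show "R y x" if "R x y" for x y using that by (auto simp: R_def)
      show "odd (length vs)"
        if "3 \<le> length vs" "distinct vs" "set vs \<subseteq> Poly_Mapping.keys u \<union> Poly_Mapping.keys v"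
          "\<forall>i<length vs. vs ! i \<noteq> vs ! (Suc i mod length vs) \<and> R (vs ! i) (vs ! (Suc i mod length vs))" for vs
        using uv(1,2) that by (intro odd) blast+
    qed (use uv in auto)
    then show ?thesis
    proof (elim disjE bexE)
      fix i j assume ij: "i \<in> Poly_Mapping.keys u" "j \<in> Poly_Mapping.keys v"
        and leaf: "\<forall>i'\<in>Poly_Mapping.keys u. i' \<noteq> i \<longrightarrow> \<not> R i' j"
      have "j < n" using ij uv by auto
      have "\<exists>c. a + e i = c + e j"
        by (rule leaf_divides[OF sqf[OF \<open>j < n\<close>] \<open>j < n\<close> ij(2) eq]) (use leaf in \<open>simp add: R_def\<close>)
      then show ?thesis using ij by blast
    next
      fix i j assume ij: "i \<in> Poly_Mapping.keys u" "j \<in> Poly_Mapping.keys v"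
        and leaf: "\<forall>j'\<in>Poly_Mapping.keys v. j' \<noteq> j \<longrightarrow> \<not> R i j'"
      have "i < n" using ij uv by auto
      \<comment> \<open>Now the leaf lies in the support of \<open>u\<close>, so the equation is
        reversed and the two sides change roles.\<close>
      have "\<exists>c. b + e j = c + e i"
        by (rule leaf_divides[OF sqf[OF \<open>i < n\<close>] \<open>i < n\<close> ij(1) eq[symmetric]])
          (use leaf in \<open>unfold R_def, blast\<close>)
      then show ?thesis using ij by blast
    qed
  qed
  have "term_of a u 1 - term_of b v 1 \<in> K"
    if "Poly_Mapping.keys u \<subseteq> {..<n}" "Poly_Mapping.keys v \<subseteq> {..<n}"
      "a + exponent n e u = b + exponent n e v" "total_degree n u = total_degree n v" for a b u v
  proof (rule binomial_in_linear_ideal[of n f e, OF f K lin _ that])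
    show "\<exists>i\<in>Poly_Mapping.keys u. \<exists>j\<in>Poly_Mapping.keys v. (\<exists>c. a + e i = c + e j) \<or> (\<exists>c. b + e j = c + e i)"
      if "Poly_Mapping.keys u \<subseteq> {..<n}" "Poly_Mapping.keys v \<subseteq> {..<n}"
        "Poly_Mapping.keys u \<inter> Poly_Mapping.keys v = {}" "u \<noteq> 0" "v \<noteq> 0"
        "a + exponent n e u = b + exponent n e v" for a b u v
      using that by (rule exchange)
  qed
  then show "rees_relations I n f \<subseteq> K"
    by (intro rees_relations_subset_if_binomials[of n f e, OF f K])
qed

end
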